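(* Let $G=(N,A,\mathbf c)$ be a general directed graph, write $J=\{1,\dots,2^{|\mathcal L|}\}$, and assume that each ambiguity set $\mathcal Q_j$, $j\in J$, is described in terms of expected costs by a polyhedral uncertainty set $\mathcal S_j=\{\overline{\mathbf c}\in\mathbb R^{|A|}:\ \mathbf B_j\overline{\mathbf c}\le\mathbf b_j\}\subseteq\mathcal S_0$. Set $M_1=|N|-1$. Then the multi-stage distributionally robust shortest path problem $(\mathbf F_{ms})$ (defined in the context) can be reformulated as the linear mixed-integer program $$z^*_{dynamic}=\min_{\mathbf y,\mathbf t,\mathbf v,\tilde{\mathbf v},\mathbf w,\boldsymbol\lambda,z}\ z$$ subject to: (1) for all $j\in J$: $$t_{j,s}=0,\qquad 0\le t_{j,i}\le|N|-1\ \ \forall i\in N,\qquad t_{j,a_1}-t_{j,a_2}\le-1+|N|(1-y_{j,a})\ \ \forall a=(a_1,a_2)\in A;$$ (2) for all $j,\ell\in J$ with $j\ne\ell$, all $n\in N_{j,\ell}$ and all $i\in N\setminus N_{j,\ell}$: $$v_{j,i,n}\ge0,\qquad v_{j,i,n}\ge t_{j,i}-t_{j,n},\qquad v_{j,i,n}\le M_1\tilde v_{j,i,n},\qquad v_{j,i,n}\le t_{j,i}-t_{j,n}+M_1(1-\tilde v_{j,i,n}),$$ $$w_{j,i,n}\le v_{j,i,n}+2-\sum_{a'\in FS_n}y_{j,a'}-\sum_{a'\in FS_i}y_{j,a'},\qquad w_{j,i,n}\le\sum_{a'\in FS_n}y_{j,a'},$$ $$-\sum_{\tilde n\in N_{j,\ell}}w_{j,i,\tilde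 n}\le y_{j,a}-y_{\ell,a}\le\sum_{\tilde n\in N_{j,\ell}}w_{j,i,\tilde n}\ \ \forall a\in FS_i,\qquad \tilde v_{j,i,n}\in\{0,1\};$$ (3) for all $j\in J$: $$z\ge\mathbf b_j^\top\boldsymbol\lambda_j,\qquad -\mathbf y_j+\mathbf B_j^\top\boldsymbol\lambda_j=0,\qquad\boldsymbol\lambda_j\ge0,\qquad\mathbf y_j\in Y.$$ That is, the optimal value $z^*_{dynamic}$ of this program equals the optimal value of $(\mathbf F_{ms})$, and the $\mathbf y$-components $(\mathbf y_j)_{j\in J}$ of an optimal solution of this program form an optimal solution of $(\mathbf F_{ms})$.
   Context: **Graph.** $G=(N,A,\mathbf c)$ is a weighted connected directed graph (possibly with directed cycles) with finite node set $N$, arc set $A$ and random nonnegative cost vector $\mathbf c=(c_a)_{a\in A}$; $s\ne f$ are fixed source and destination nodes. An arc is written $a=(a_1,a_2)$ with tail $a_1$ and head $a_2$. $FS_i$ ($RS_i$) is the set of arcs directed out of (into) node $i$. **Feasible paths.** Each node may be visited at most once, and the user's decisions are incidence vectors of such $s$–$f$ paths. In the linear program, $Y$ denotes the set of $\mathbf y\in\{0,1\}^{|A|}$ such that, for all $i\in N$, $\sum_{a\in FS_i}y_a-\sum_{a\in RS_i}y_a=1$ if $i=s$, $=-1$ if $i=f$, $=0$ otherwise, and $\sum_{a\in FS_i}y_a\le1$. **Initial ambiguity set.** $\mathcal Q$ is the set of all probability distributions $\mathbb Q$ on $\mathbb R^{|A|}$ (marginals $\mathbb Q_a$) satisfying both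 of the following: - $\mathbb Q_a\{c_a\in[l_a^{(m)},u_a^{(m)}]\}\in[\underline q_a^{(m)},\overline q_a^{(m)}]$ for all $a\in A$ and $m\in\{1,\dots,d_a\}$. For $m=1$ this is a support constraint: $[l^{(1)}_a,u^{(1)}_a]=[l_a,u_a]$ with $0\le l_a\le u_a<\infty$ and $\underline q_a^{(1)}=\overline q_a^{(1)}=1$. - $\mathbb E_{\mathbb Q}\{\mathbf B\mathbf c\}\le\mathbf b$, for a given real matrix $\mathbf B$ with $|A|$ columns and a vector $\mathbf b$. **Auxiliary constraints and responses.** $\mathcal L$ is a finite list of constraints. Each is associated with a node $i\in N\setminus\{f\}$ and has one of the following two forms: - $\mathbb Q_a\{c_a\in[\widetilde l_a,\widetilde u_a]\}\le\widetilde q_a$ for some $a\in FS_i$; - $\mathbb E_{\mathbb Q}\{\sum_{a\in FS_i}p_ac_a\}\le p_0$. Let $\mathbf r_1,\dots,\mathbf r_{2^{|\mathcal L|}}$ enumerate $\{0,1\}^{|\mathcal L|}$ (the attacker's response vectors). $\mathcal Q_j$ is the set of $\mathbb Q\in\mathcal Q$ that, for every $m$, satisfy the $m$-th constraint of $\mathcal L$ if $r_{jm}=1$ and its opposite if $r_{jm}=0$. The opposite of "$v\le w$" is "$v\ge w$". **Polyhedral description.** "$\mathcal Q_j$ is described by $\mathcal S_j$ in terms of expected costs" means $\{\mathbb E_{\mathbb Q}\{\mathbf c\}:\mathbb Q\in\mathcal Q_j\}=\mathcal S_j$. The set $\mathcal S_0=\{\overline{\mathbf c}:\mathbf L\le\overline{\mathbf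 c}\le\mathbf U,\ \mathbf B\overline{\mathbf c}\le\mathbf b\}$ is the analogous polyhedron for $\mathcal Q$, where $L_a$ and $U_a$ are the minimal and maximal expected values of $c_a$ over marginals satisfying the individual probability constraints. Similarly, the system $\mathbf B_j\overline{\mathbf c}\le\mathbf b_j$ consists of finite lower and upper bounds on every $\overline c_a$ together with the linear expectation constraints defining $\mathcal Q_j$. Some $\mathcal S_j$ may be empty; a maximum over an empty set is $-\infty$. **Distinguishing nodes.** For $j\ne\ell$, $N_{j,\ell}\subseteq N\setminus\{f\}$ is the set of nodes $i$ for which some constraint in $\mathcal L$ associated with $i$, say the $m$-th, satisfies $r_{jm}\ne r_{\ell m}$. **Non-anticipativity.** A pair of paths $(P_j,P_\ell)$, $j\neq\ell$, is non-anticipative if they coincide until a node of $N_{j,\ell}$ is reached. Precisely: if $P_j$ contains no node of $N_{j,\ell}$, then $P_j=P_\ell$; otherwise, if $n$ is the first node of $P_j$ in $N_{j,\ell}$, then $P_\ell$ contains $n$ and the initial segments of $P_j$ and $P_\ell$ from $s$ up to $n$ are identical. **Multi-stage problem $(\mathbf F_{ms})$.** The user chooses a family $(\mathbf y_j)_{j\in J}$, where each $\mathbf y_j$ is the incidence vector of an $s$–$f$ path $P_j$ visiting each node at most once and all pairs $(P_j,P_\ell)$, $j\ne\ell$, are non-anticipative. The aim is to minimize the worst-case expected loss $$\max_{j\in J}\ \max_{\mathbb Q_j\in\mathcal Q_j}\ \mathbb E_{\mathbb Q_j}\{\mathbf c^\top\mathbf y_j\}.$$ *)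

theory Defs
  imports "HOL-Probability.Probability" "Graph_Theory.Graph_Theory"
begin

text \<open>
  Arcs are the elements of a finite type \<open>'e\<close>, so a cost vector is an element of \<open>real ^ 'e\<close> and a
  joint distribution of the costs is a measure on that space.
  A system \<open>M c \<le> q\<close> of linear inequalities is the list of its rows \<open>(p, q)\<close>, each of
  which reads \<open>p \<bullet> c \<le> q\<close>.
\<close>

type_synonym 'e linsys = "((real ^ 'e) \<times> real) list"

definition solution_set :: "'e::finite linsys \<Rightarrow> (real ^ 'e) set" where
  "solution_set S = {c. \<forall>(p, q) \<in> set S. p \<bullet> c \<le> q}"


subsection \<open>Ambiguity sets\<close>

definition distributions :: "'x::topological_space measure set" where
  "distributions = {Q. prob_space Q \<and> sets Q = sets borel}"

definition marginal :: "(real ^ 'e::finite) measure \<Rightarrow> 'e \<Rightarrow> real measure" where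
  "marginal Q a = distr Q borel (\<lambda>c. c $ a)"

text \<open>
  For an arc \<open>a\<close> there are \<open>d a\<close> individual probability constraints: the \<open>m\<close>-th one
  bounds the probability of the interval from \<open>l a m\<close> to \<open>u a m\<close> by \<open>ql a m\<close> and \<open>qu a m\<close>.
\<close>

definition marginal_set ::
  "('e \<Rightarrow> nat) \<Rightarrow> ('e \<Rightarrow> nat \<Rightarrow> real) \<Rightarrow> ('e \<Rightarrow> nat \<Rightarrow> real) \<Rightarrow> ('e \<Rightarrow> nat \<Rightarrow> real) \<Rightarrow> ('e \<Rightarrow> nat \<Rightarrow> real)
   \<Rightarrow> 'e \<Rightarrow> real measure set" where
  "marginal_set d l u ql qu a =
     {M \<in> distributions. \<forall>m \<in> {1..d a}. measure M {l a m..u a m} \<in> {ql a m..qu a m}}"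

text \<open>
  The expectation constraints \<open>E\<close> are imposed row by row. When the first interval of each arc
  is a bounded support interval, all expectations below are of bounded random variables.
\<close>

definition ambiguity_set ::
  "('e::finite \<Rightarrow> nat) \<Rightarrow> ('e \<Rightarrow> nat \<Rightarrow> real) \<Rightarrow> ('e \<Rightarrow> nat \<Rightarrow> real) \<Rightarrow> ('e \<Rightarrow> nat \<Rightarrow> real) \<Rightarrow> ('e \<Rightarrow> nat \<Rightarrow> real)
   \<Rightarrow> 'e linsys \<Rightarrow> (real ^ 'e) measure set" where
  "ambiguity_set d l u ql qu E =
     {Q \<in> distributions. (\<forall>a. marginal Q a \<in> marginal_set d l u ql qu a) \<and>
        (\<forall>(p, q) \<in> set E. (\<integral>c. p \<bullet> c \<partial>Q) \<le> q)}"

definition expected_costs :: "(real ^ 'e::finite) measure set \<Rightarrow> (real ^ 'e) set" where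
  "expected_costs \<Q> = (\<lambda>Q. \<integral>c. c \<partial>Q) ` \<Q>"

definition initial_polyhedron ::
  "('e::finite \<Rightarrow> nat) \<Rightarrow> ('e \<Rightarrow> nat \<Rightarrow> real) \<Rightarrow> ('e \<Rightarrow> nat \<Rightarrow> real) \<Rightarrow> ('e \<Rightarrow> nat \<Rightarrow> real) \<Rightarrow> ('e \<Rightarrow> nat \<Rightarrow> real)
   \<Rightarrow> 'e linsys \<Rightarrow> (real ^ 'e) set" where
  "initial_polyhedron d l u ql qu E =
     {c. \<forall>a. (INF M \<in> marginal_set d l u ql qu a. \<integral>x. x \<partial>M) \<le> c $ a \<and>
             c $ a \<le> (SUP M \<in> marginal_set d l u ql qu a. \<integral>x. x \<partial>M)}
     \<inter> solution_set E"


subsection \<open>Auxiliary constraints and responses\<close>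

datatype ('n, 'e) aux_constraint =
    Prob_Constraint (assoc_node: 'n) 'e real real real
  | Exp_Constraint (assoc_node: 'n) "real ^ 'e" real

fun aux_lhs :: "('n, 'e::finite) pre_digraph \<Rightarrow> (real ^ 'e) measure \<Rightarrow> ('n, 'e) aux_constraint \<Rightarrow> real" where
  "aux_lhs G Q (Prob_Constraint i a lo up q) = measure (marginal Q a) {lo..up}"
| "aux_lhs G Q (Exp_Constraint i p p0) = (\<integral>c. (\<Sum>a\<in>out_arcs G i. p $ a * c $ a) \<partial>Q)"

fun aux_rhs :: "('n, 'e::finite) aux_constraint \<Rightarrow> real" where
  "aux_rhs (Prob_Constraint i a lo up q) = q"
| "aux_rhs (Exp_Constraint i p p0) = p0"

fun aux_wf :: "('n, 'e::finite) pre_digraph \<Rightarrow> 'n \<Rightarrow> ('n, 'e) aux_constraint \<Rightarrow> bool" where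
  "aux_wf G f (Prob_Constraint i a lo up q) \<longleftrightarrow> i \<in> verts G - {f} \<and> a \<in> out_arcs G i"
| "aux_wf G f (Exp_Constraint i p p0) \<longleftrightarrow> i \<in> verts G - {f}"

text \<open>A response vector is a list of truth values of the same length as the list of constraints.\<close>

definition response_set ::
  "('n, 'e::finite) pre_digraph \<Rightarrow> (real ^ 'e) measure set \<Rightarrow> ('n, 'e) aux_constraint list \<Rightarrow> bool list
   \<Rightarrow> (real ^ 'e) measure set" where
  "response_set G \<Q> L \<rho> =
     {Q \<in> \<Q>. \<forall>m < length L. if \<rho> ! m then aux_lhs G Q (L ! m) \<le> aux_rhs (L ! m)
                             else aux_lhs G Q (L ! m) \<ge> aux_rhs (L ! m)}"

definition distinguishing_nodes ::
  "('n, 'e::finite) aux_constraint list \<Rightarrow> bool list \<Rightarrow> bool list \<Rightarrow> 'n set" where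
  "distinguishing_nodes L \<rho> \<rho>' = {assoc_node (L ! m) | m. m < length L \<and> \<rho> ! m \<noteq> \<rho>' ! m}"

definition expectation_rows ::
  "('n, 'e::finite) pre_digraph \<Rightarrow> ('n, 'e) aux_constraint list \<Rightarrow> bool list \<Rightarrow> ((real ^ 'e) \<times> real) set" where
  "expectation_rows G L \<rho> =
     {let row = (\<chi> a. if a \<in> out_arcs G i then p $ a else 0)
      in if \<rho> ! m then (row, p0) else (- row, - p0)
      | m i p p0. m < length L \<and> L ! m = Exp_Constraint i p p0}"

text \<open>
  The system consists of a lower and an upper bound on every component, the rows of the
  expectation constraints \<open>E\<close>, and the rows of the expectation constraints in \<open>L\<close>, oriented
  according to the response vector.
\<close>

definition response_system ::
  "('n, 'e::finite) pre_digraph \<Rightarrow> 'e linsys \<Rightarrow> ('n, 'e) aux_constraint list \<Rightarrow> bool list \<Rightarrow> 'e linsys \<Rightarrow> bool" where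
  "response_system G E L \<rho> S \<longleftrightarrow>
     (\<exists>lb ub :: real ^ 'e.
        set S = (\<Union>a. {(- axis a 1, - (lb $ a)), (axis a 1, ub $ a)}) \<union> set E \<union> expectation_rows G L \<rho>)"


subsection \<open>The multi-stage problem\<close>

definition incidence_vector :: "'e list \<Rightarrow> real ^ 'e::finite" where
  "incidence_vector p = (\<chi> a. if a \<in> set p then 1 else 0)"

text \<open>
  A path is given by its list of arcs. On a simple path from \<open>s\<close> to \<open>f\<close> that contains
  the node \<open>n \<noteq> f\<close>, the arcs before the one leaving \<open>n\<close> form the initial segment up to \<open>n\<close>.
\<close>

definition path_up_to :: "('n, 'e) pre_digraph \<Rightarrow> 'n \<Rightarrow> 'e list \<Rightarrow> 'e list" where
  "path_up_to G n p = takeWhile (\<lambda>a. tail G a \<noteq> n) p"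

definition nonanticipative :: "('n, 'e) pre_digraph \<Rightarrow> 'n \<Rightarrow> 'n set \<Rightarrow> 'e list \<Rightarrow> 'e list \<Rightarrow> bool" where
  "nonanticipative G s D p p' \<longleftrightarrow>
     (let vs = pre_digraph.awalk_verts G s p; vs' = pre_digraph.awalk_verts G s p'
      in if set vs \<inter> D = {} then p = p'
         else let n = hd (filter (\<lambda>v. v \<in> D) vs)
              in n \<in> set vs' \<and> path_up_to G n p = path_up_to G n p')"

text \<open>In what follows, \<open>J\<close> is the set of scenarios and \<open>D j k\<close> the set of nodes that distinguish \<open>j\<close> from \<open>k\<close>.\<close>

definition ms_feasible ::
  "('n, 'e::finite) pre_digraph \<Rightarrow> 'n \<Rightarrow> 'n \<Rightarrow> nat set \<Rightarrow> (nat \<Rightarrow> nat \<Rightarrow> 'n set) \<Rightarrow> (nat \<Rightarrow> real ^ 'e) set" where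
  "ms_feasible G s f J D =
     {y. \<exists>P. (\<forall>j\<in>J. pre_digraph.apath G s (P j) f \<and> y j = incidence_vector (P j)) \<and>
             (\<forall>j\<in>J. \<forall>k\<in>J. j \<noteq> k \<longrightarrow> nonanticipative G s (D j k) (P j) (P k))}"

definition ms_loss ::
  "nat set \<Rightarrow> (nat \<Rightarrow> (real ^ 'e::finite) measure set) \<Rightarrow> (nat \<Rightarrow> real ^ 'e) \<Rightarrow> ereal" where
  "ms_loss J \<Q> y = (SUP j\<in>J. SUP Q\<in>\<Q> j. ereal (\<integral>c. c \<bullet> y j \<partial>Q))"


subsection \<open>The mixed-integer program\<close>

definition flow_vectors :: "('n, 'e::finite) pre_digraph \<Rightarrow> 'n \<Rightarrow> 'n \<Rightarrow> (real ^ 'e) set" where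
  "flow_vectors G s f =
     {y. (\<forall>a. y $ a \<in> {0, 1}) \<and>
         (\<forall>i\<in>verts G.
            (\<Sum>a\<in>out_arcs G i. y $ a) - (\<Sum>a\<in>in_arcs G i. y $ a)
              = (if i = s then 1 else if i = f then -1 else 0) \<and>
            (\<Sum>a\<in>out_arcs G i. y $ a) \<le> 1)}"

text \<open>
  Index sets are not part of the types below: only the values at \<open>j \<in> J\<close>, at nodes of the graph and,
  for \<open>lam_var j\<close>, at positions of the rows of the system \<open>S j\<close> occur in the constraints.
\<close>

record ('n, 'e) milp_vars =
  y_var :: "nat \<Rightarrow> real ^ 'e"
  t_var :: "nat \<Rightarrow> 'n \<Rightarrow> real"
  v_var :: "nat \<Rightarrow> 'n \<Rightarrow> 'n \<Rightarrow> real"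
  vt_var :: "nat \<Rightarrow> 'n \<Rightarrow> 'n \<Rightarrow> real"
  w_var :: "nat \<Rightarrow> 'n \<Rightarrow> 'n \<Rightarrow> real"
  lam_var :: "nat \<Rightarrow> nat \<Rightarrow> real"
  z_var :: real

definition ordering_constraints ::
  "('n, 'e::finite) pre_digraph \<Rightarrow> 'n \<Rightarrow> nat set \<Rightarrow> ('n, 'e) milp_vars \<Rightarrow> bool" where
  "ordering_constraints G s J x \<longleftrightarrow>
     (\<forall>j\<in>J.
        t_var x j s = 0 \<and>
        (\<forall>i\<in>verts G. 0 \<le> t_var x j i \<and> t_var x j i \<le> real (card (verts G)) - 1) \<and>
        (\<forall>a\<in>arcs G. t_var x j (tail G a) - t_var x j (head G a)
                       \<le> -1 + real (card (verts G)) * (1 - y_var x j $ a)))"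

definition nonanticipativity_constraints ::
  "('n, 'e::finite) pre_digraph \<Rightarrow> nat set \<Rightarrow> (nat \<Rightarrow> nat \<Rightarrow> 'n set) \<Rightarrow> ('n, 'e) milp_vars \<Rightarrow> bool" where
  "nonanticipativity_constraints G J D x \<longleftrightarrow>
     (let M1 = real (card (verts G)) - 1 in
      \<forall>j\<in>J. \<forall>k\<in>J. j \<noteq> k \<longrightarrow> (\<forall>n\<in>D j k. \<forall>i\<in>verts G - D j k.
        0 \<le> v_var x j i n \<and>
        t_var x j i - t_var x j n \<le> v_var x j i n \<and>
        v_var x j i n \<le> M1 * vt_var x j i n \<and>
        v_var x j i n \<le> t_var x j i - t_var x j n + M1 * (1 - vt_var x j i n) \<and>
        w_var x j i n \<le> v_var x j i n + 2 - (\<Sum>a\<in>out_arcs G n. y_var x j $ a)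
                                         - (\<Sum>a\<in>out_arcs G i. y_var x j $ a) \<and>
        w_var x j i n \<le> (\<Sum>a\<in>out_arcs G n. y_var x j $ a) \<and>
        (\<forall>a\<in>out_arcs G i.
           - (\<Sum>n'\<in>D j k. w_var x j i n') \<le> y_var x j $ a - y_var x k $ a \<and>
           y_var x j $ a - y_var x k $ a \<le> (\<Sum>n'\<in>D j k. w_var x j i n')) \<and>
        vt_var x j i n \<in> {0, 1}))"

definition dual_constraints ::
  "nat set \<Rightarrow> (nat \<Rightarrow> 'e::finite linsys) \<Rightarrow> ('n, 'e) milp_vars \<Rightarrow> bool" where
  "dual_constraints J S x \<longleftrightarrow>
     (\<forall>j\<in>J.
        (\<Sum>r<length (S j). snd (S j ! r) * lam_var x j r) \<le> z_var x \<and>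
        - y_var x j + (\<Sum>r<length (S j). lam_var x j r *\<^sub>R fst (S j ! r)) = 0 \<and>
        (\<forall>r<length (S j). 0 \<le> lam_var x j r))"

definition milp_feasible ::
  "('n, 'e::finite) pre_digraph \<Rightarrow> 'n \<Rightarrow> 'n \<Rightarrow> nat set \<Rightarrow> (nat \<Rightarrow> nat \<Rightarrow> 'n set) \<Rightarrow> (nat \<Rightarrow> 'e linsys)
   \<Rightarrow> ('n, 'e) milp_vars set" where
  "milp_feasible G s f J D S =
     {x. ordering_constraints G s J x \<and> nonanticipativity_constraints G J D x \<and>
         dual_constraints J S x \<and> (\<forall>j\<in>J. y_var x j \<in> flow_vectors G s f)}"

end

theory Submission
  imports Defs
begin

text \<open>
  For fixed \<open>y\<close> and \<open>z\<close> the remaining variables of the program can be completed to a feasible point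
  if and only if \<open>y\<close> is feasible for the multi-stage problem with loss at most \<open>z\<close>; as only finitely
  many losses occur, this gives the equality of values and attainment.
  The ordering variables exclude cycles, so a flow is an \<open>s\<close>-\<open>f\<close> path along which \<open>t\<close> increases.
  For a node \<open>i\<close> of the path of \<open>j\<close> that precedes all distinguishing nodes on it, the variables \<open>w\<close>
  are forced to be nonpositive, so \<open>y\<^sub>j\<close> and \<open>y\<^sub>k\<close> agree on the arcs out of \<open>i\<close>; for every other
  \<open>i\<close> they can be chosen to sum to at least \<open>1\<close>. Both sides therefore say that the two paths have
  the same maximal initial segment of arcs whose tails do not distinguish \<open>j\<close> from \<open>k\<close>.
  Finally, \<open>z\<close> bounds the worst-case expectation over \<open>\<Q> j\<close> iff the dual of the linear program over
  \<open>solution_set (S j)\<close> has a feasible point of value at most \<open>z\<close>.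
\<close>

section \<open>Linear programming duality\<close>

text \<open>The nonnegative combinations already form a convex cone containing the generators.
  Coefficients are indexed by positions and not by elements, since each row of a system, repeated or
  not, carries its own dual variable.\<close>

lemma convex_cone_hull_list:
  fixes xs :: "'a::real_vector list"
  assumes "x \<in> convex_cone hull (set xs)"
  obtains \<alpha> where "\<And>i. 0 \<le> \<alpha> i" "x = (\<Sum>i<length xs. \<alpha> i *\<^sub>R xs ! i)"
proof -
  define K where "K = {(\<Sum>i<length xs. \<alpha> i *\<^sub>R xs ! i) | \<alpha>. \<forall>i. 0 \<le> (\<alpha> i :: real)}"
  have "set xs \<subseteq> K"
  proof
    fix y assume "y \<in> set xs"
    then obtain k where k: "k < length xs" "y = xs ! k"
      by (auto simp: in_set_conv_nth)
    have "y = (\<Sum>i<length xs. (if i = k then 1 else 0) *\<^sub>R xs ! i)"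
      using k by (simp add: if_distrib[of "\<lambda>c. c *\<^sub>R _"] sum.delta cong: if_cong)
    then show "y \<in> K"
      unfolding K_def by (intro CollectI exI[of _ "\<lambda>i. if i = k then 1 else 0"]) simp
  qed
  moreover have "convex_cone K"
    unfolding convex_cone_iff
  proof (intro conjI ballI allI impI)
    show "0 \<in> K"
      unfolding K_def by (auto intro!: exI[of _ "\<lambda>_. 0"])
    fix y z assume "y \<in> K" "z \<in> K"
    then obtain \<mu> \<nu> where "\<forall>i. 0 \<le> \<mu> i" "\<forall>i. 0 \<le> \<nu> i"
        "y = (\<Sum>i<length xs. \<mu> i *\<^sub>R xs ! i)" "z = (\<Sum>i<length xs. \<nu> i *\<^sub>R xs ! i)"
      unfolding K_def by blast
    then show "y + z \<in> K"
      unfolding K_def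
      by (intro CollectI exI[of _ "\<lambda>i. \<mu> i + \<nu> i"]) (simp add: scaleR_add_left sum.distrib)
  next
    fix y and c :: real assume "y \<in> K" "0 \<le> c"
    then obtain \<mu> where "\<forall>i. 0 \<le> \<mu> i" "y = (\<Sum>i<length xs. \<mu> i *\<^sub>R xs ! i)"
      unfolding K_def by blast
    with \<open>0 \<le> c\<close> show "c *\<^sub>R y \<in> K"
      unfolding K_def
      by (intro CollectI exI[of _ "\<lambda>i. c * \<mu> i"]) (simp add: scaleR_sum_right)
  qed
  ultimately have "convex_cone hull (set xs) \<subseteq> K"
    by (simp add: hull_minimal)
  with assms have "x \<in> K" ..
  then show ?thesis
    unfolding K_def using that by blast
qed

text \<open>Strict separation puts \<open>K\<close> above a level \<open>b\<close>, and
  \<open>b < 0\<close> because \<open>0 \<in> K\<close>. A point of \<open>K\<close> with negative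
  product could be rescaled inside \<open>K\<close> until the product equals \<open>b\<close>,
  contradicting strictness; hence the level can be moved to 0.\<close>

lemma convex_cone_separation:
  fixes K :: "'a::euclidean_space set"
  assumes "convex_cone K" "closed K" "x \<notin> K"
  obtains a where "a \<bullet> x < 0" "\<And>y. y \<in> K \<Longrightarrow> 0 \<le> a \<bullet> y"
proof -
  have K: "convex K" "conic K" "0 \<in> K"
    using assms(1) convex_cone_contains_0 by (auto simp: convex_cone_def)
  obtain a b where ab: "a \<bullet> x < b" "\<And>y. y \<in> K \<Longrightarrow> b < a \<bullet> y"
    using separating_hyperplane_closed_point[OF K(1) assms(2,3)] by blast
  have "b < 0"
    using ab(2)[OF K(3)] by simp
  have "0 \<le> a \<bullet> y" if "y \<in> K" for y
  proof (rule ccontr)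
    assume neg: "\<not> 0 \<le> a \<bullet> y"
    have "(b / (a \<bullet> y)) *\<^sub>R y \<in> K"
      using K(2) that neg \<open>b < 0\<close> by (intro conicD) (auto simp: divide_nonpos_nonpos)
    from ab(2)[OF this] neg show False
      by simp
  qed
  with ab(1) \<open>b < 0\<close> show ?thesis
    by (intro that) auto
qed

lemma weak_duality:
  assumes "c \<in> solution_set S" "\<And>k. k < length S \<Longrightarrow> 0 \<le> \<alpha> k"
  shows "c \<bullet> (\<Sum>k<length S. \<alpha> k *\<^sub>R fst (S ! k)) \<le> (\<Sum>k<length S. snd (S ! k) * \<alpha> k)"
proof -
  have "c \<bullet> fst (S ! k) \<le> snd (S ! k)" if "k < length S" for k
  proof -
    have "S ! k \<in> set S"
      using that by simp
    with assms(1) show ?thesis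
      unfolding solution_set_def by (metis (mono_tags, lifting) case_prod_beta inner_commute mem_Collect_eq)
  qed
  then show ?thesis
    by (auto simp: inner_sum_right mult.commute[of "snd _"] intro!: sum_mono mult_left_mono assms(2))
qed

text \<open>
  The bounds on the components also cover an empty solution set: a separating functional that
  vanishes on the last component would be a nonzero recession direction of the system.
\<close>

lemma strong_duality:
  fixes S :: "'e::finite linsys" and lb ub :: "real ^ 'e"
  assumes bounds: "\<And>a. (- axis a 1, - (lb $ a)) \<in> set S" "\<And>a. (axis a 1, ub $ a) \<in> set S"
    and le: "\<And>c. c \<in> solution_set S \<Longrightarrow> c \<bullet> y \<le> z"
  obtains \<alpha> where "\<And>k. 0 \<le> \<alpha> k" "y = (\<Sum>k<length S. \<alpha> k *\<^sub>R fst (S ! k))"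
    "(\<Sum>k<length S. snd (S ! k) * \<alpha> k) \<le> z"
proof -
  \<comment> \<open>The extra generator \<open>(0, 1)\<close> acts as a slack: membership of
    \<open>(y, z)\<close> in the cone means that \<open>y\<close> combines the left-hand sides at a
    cost of at most \<open>z\<close>.\<close>
  define xs where "xs = (0 :: real ^ 'e, 1 :: real) # S"
  have "(y, z) \<in> convex_cone hull (set xs)"
  proof (rule ccontr)
    assume "(y, z) \<notin> convex_cone hull (set xs)"
    then obtain w where w: "w \<bullet> (y, z) < 0"
        "\<And>x. x \<in> convex_cone hull (set xs) \<Longrightarrow> 0 \<le> w \<bullet> x"
      by (rule convex_cone_separation[rotated 2])
        (auto simp: convex_cone_convex_cone_hull closed_convex_cone_hull)
    obtain c' t where "w = (c', t)"
      by (cases w)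
    define c where "c = - c'"
    have yz: "t * z < c \<bullet> y"
      using w(1) by (simp add: \<open>w = (c', t)\<close> c_def)
    have row: "c \<bullet> p \<le> t * q" if "(p, q) \<in> set xs" for p q
      using w(2)[OF hull_inc[OF that]] by (simp add: \<open>w = (c', t)\<close> c_def)
    have "0 \<le> t"
      using row[of 0 1] by (simp add: xs_def)
    show False
    proof (cases "t = 0")
      case True
      have "c = 0"
      proof (subst vec_eq_iff, rule allI)
        fix a
        show "c $ a = 0 $ a"
          using row[of "- axis a 1" "- (lb $ a)"] row[of "axis a 1" "ub $ a"] bounds[of a]
          by (simp add: True xs_def inner_axis)
      qed
      with True yz show False
        by simp
    next
      case False
      with \<open>0 \<le> t\<close> have "0 < t"
        by simp
      \<comment> \<open>For \<open>t > 0\<close>, normalizing the separating functional yields a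
        primal feasible point whose objective exceeds \<open>z\<close>.\<close>
      have "(1 / t) *\<^sub>R c \<in> solution_set S"
        unfolding solution_set_def using row \<open>0 < t\<close>
        by (auto simp: xs_def inner_commute field_simps)
      from le[OF this] yz \<open>0 < t\<close> show False
        by (simp add: field_simps)
    qed
  qed
  then obtain \<mu> where \<mu>: "\<And>i. 0 \<le> \<mu> i" "(y, z) = (\<Sum>i<length xs. \<mu> i *\<^sub>R xs ! i)"
    using convex_cone_hull_list by blast
  \<comment> \<open>The coefficient at position 0 belongs to the slack generator, so the dual
    variables are the coefficients shifted by one.\<close>
  have sum: "(y, z) = \<mu> 0 *\<^sub>R (0, 1) + (\<Sum>k<length S. \<mu> (Suc k) *\<^sub>R S ! k)"
    unfolding \<mu>(2) xs_def by (simp only: length_Cons sum.lessThan_Suc_shift) simp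
  show ?thesis
  proof (rule that[of "\<lambda>k. \<mu> (Suc k)"])
    show "y = (\<Sum>k<length S. \<mu> (Suc k) *\<^sub>R fst (S ! k))"
      using arg_cong[OF sum, of fst] by (simp add: fst_sum)
    have "z = \<mu> 0 + (\<Sum>k<length S. \<mu> (Suc k) * snd (S ! k))"
      using arg_cong[OF sum, of snd] by (simp add: snd_sum)
    then show "(\<Sum>k<length S. snd (S ! k) * \<mu> (Suc k)) \<le> z"
      using \<mu>(1)[of 0] by (simp add: mult.commute)
  qed (rule \<mu>(1))
qed



section \<open>Paths and flows\<close>

lemma incidence_vector_nth [simp]: "incidence_vector p $ a = (if a \<in> set p then 1 else 0)"
  by (simp add: incidence_vector_def)

context wf_digraph
begin

section \<open>Node sequences and initial segments of simple paths\<close>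

lemma awalk_verts_tails: "awalk u p v \<Longrightarrow> awalk_verts u p = map (tail G) p @ [v]"
  by (induction p arbitrary: u) (auto simp: awalk_simps)

lemma awalk_verts_heads: "awalk u p v \<Longrightarrow> awalk_verts u p = u # map (head G) p"
  by (induction p arbitrary: u) (auto simp: awalk_simps)

text \<open>The nodes of a walk are its tails followed by \<open>v\<close>, and also
  \<open>u\<close> followed by its heads. Distinctness of the nodes gives the first four facts,
  comparing the two lists gives the last.\<close>

lemma
  assumes "apath u p v"
  shows apath_distinct_tails: "distinct (map (tail G) p)"
    and apath_end_not_tail: "v \<notin> tail G ` set p"
    and apath_distinct_heads: "distinct (map (head G) p)"
    and apath_start_not_head: "u \<notin> head G ` set p"
    and apath_tails_heads: "insert v (tail G ` set p) = insert u (head G ` set p)"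
proof -
  have p: "awalk u p v" "distinct (awalk_verts u p)"
    using assms by (auto simp: apath_def)
  then show "distinct (map (tail G) p)" "v \<notin> tail G ` set p"
    by (auto simp: awalk_verts_tails)
  from p show "distinct (map (head G) p)" "u \<notin> head G ` set p"
    by (auto simp: awalk_verts_heads)
  have "map (tail G) p @ [v] = u # map (head G) p"
    using p(1) by (simp flip: awalk_verts_tails awalk_verts_heads)
  then have "set (map (tail G) p @ [v]) = set (u # map (head G) p)"
    by (rule arg_cong)
  then show "insert v (tail G ` set p) = insert u (head G ` set p)"
    by simp
qed

lemma apath_tail_inj:
  assumes "apath u p v" "a \<in> set p" "b \<in> set p" "tail G a = tail G b"
  shows "a = b"
  using apath_distinct_tails[OF assms(1)] assms(2-) by (auto simp: distinct_map dest: inj_onD)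

text \<open>A potential that rises along every arc cannot repeat a node. This makes walks along a
  flow simple and lets the ordering variables reflect the order of nodes on a path.\<close>

lemma awalk_sorted:
  fixes t :: "'a \<Rightarrow> real"
  assumes "awalk u p v" "\<And>a. a \<in> set p \<Longrightarrow> t (tail G a) < t (head G a)"
  shows "sorted_wrt (<) (map t (awalk_verts u p))"
  using assms
proof (induction p arbitrary: u)
  case (Cons a p)
  then have "awalk (head G a) p v"
    by (simp add: awalk_simps)
  from Cons.IH[OF this] Cons.prems(2) have "sorted_wrt (<) (map t (awalk_verts (head G a) p))"
    by simp
  moreover from this have "t (tail G a) < t w" if "w \<in> set (awalk_verts (head G a) p)" for w
    using that Cons.prems(2)[of a] awalk_verts_heads[OF \<open>awalk (head G a) p v\<close>] by auto
  ultimately show ?case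
    by simp
qed simp

text \<open>Induction along the path. If the start node is in \<open>D\<close>, both initial
  segments are empty; otherwise both sides force equal first arcs and reduce to the remaining paths.
  The right-hand side no longer mentions a first distinguishing node and is symmetric in
  \<open>p\<close> and \<open>p'\<close>.\<close>

lemma nonanticipative_iff_takeWhile:
  assumes "apath s p f" "apath s p' f" "f \<notin> D"
  shows "nonanticipative G s D p p'
    \<longleftrightarrow> takeWhile (\<lambda>a. tail G a \<notin> D) p = takeWhile (\<lambda>a. tail G a \<notin> D) p'"
  using assms(1,2)
proof (induction p arbitrary: s p')
  case Nil
  then have "p' = []"
    using apath_nonempty_ends by (force simp: apath_simps)
  with Nil assms(3) show ?case
    by (simp add: nonanticipative_def apath_simps)
next
  case (Cons a q)
  have "s \<noteq> f"
    using apath_nonempty_ends[OF Cons.prems(1)] by simp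
  with Cons.prems(2) obtain a' q' where p': "p' = a' # q'"
    by (cases p') (auto simp: apath_simps)
  have tails: "tail G a = s" "tail G a' = s"
    using Cons.prems by (auto simp: p' apath_simps)
  have q: "apath (head G a) q f" "apath (head G a') q' f"
    using Cons.prems by (auto simp: p' apath_simps)
  show ?case
  proof (cases "s \<in> D")
    case True
    then show ?thesis
      by (simp add: nonanticipative_def path_up_to_def p' tails)
  next
    case False
    define n where "n = hd (filter (\<lambda>v. v \<in> D) (awalk_verts (head G a) q))"
    \<comment> \<open>Since the first distinguishing node differs from \<open>s\<close>, both
      initial segments up to it keep their first arc.\<close>
    have n: "n \<noteq> s" if "set (awalk_verts (head G a) q) \<inter> D \<noteq> {}"
    proof -
      have "filter (\<lambda>v. v \<in> D) (awalk_verts (head G a) q) \<noteq> []"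
        using that by (auto simp: filter_empty_conv)
      then have "n \<in> set (filter (\<lambda>v. v \<in> D) (awalk_verts (head G a) q))"
        unfolding n_def by (rule hd_in_set)
      with False show ?thesis
        by auto
    qed
    have "nonanticipative G s D (a # q) p' \<longleftrightarrow> a = a' \<and> nonanticipative G (head G a) D q q'"
      using False n
      by (auto simp: nonanticipative_def Let_def path_up_to_def p' tails simp flip: n_def)
    also have "\<dots> \<longleftrightarrow> a = a' \<and>
        takeWhile (\<lambda>a. tail G a \<notin> D) q = takeWhile (\<lambda>a. tail G a \<notin> D) q'"
      using Cons.IH q by auto
    finally show ?thesis
      using False by (simp add: p' tails)
  qed
qed

text \<open>A simple path leaves each node by one arc only. So the first arc of \<open>p\<close>,
  once it occurs in \<open>p'\<close>, must be the first arc of \<open>p'\<close>, and the argument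
  repeats from its head.\<close>

lemma takeWhile_eq_if_subset:
  assumes "apath s p f" "apath s p' f" "set (takeWhile (\<lambda>a. tail G a \<notin> D) p) \<subseteq> set p'"
  shows "takeWhile (\<lambda>a. tail G a \<notin> D) p = takeWhile (\<lambda>a. tail G a \<notin> D) p'"
  using assms
proof (induction p arbitrary: s p')
  case Nil
  then have "p' = []"
    using apath_nonempty_ends by (force simp: apath_simps)
  then show ?case
    by simp
next
  case (Cons a q)
  have "s \<noteq> f"
    using apath_nonempty_ends[OF Cons.prems(1)] by simp
  with Cons.prems(2) obtain a' q' where p': "p' = a' # q'"
    by (cases p') (auto simp: apath_simps)
  have tails: "tail G a = s" "tail G a' = s"
    using Cons.prems by (auto simp: p' apath_simps)
  have q: "apath (head G a) q f" "apath (head G a') q' f"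
    using Cons.prems by (auto simp: p' apath_simps)
  show ?case
  proof (cases "s \<in> D")
    case False
    have "a \<in> set p'"
      using Cons.prems(3) False by (simp add: tails)
    then have "a = a'"
      using apath_tail_inj[OF Cons.prems(2)] by (simp add: p' tails)
    \<comment> \<open>As \<open>a\<close> does not recur in \<open>q\<close>, the inclusion survives
      removing the common first arc.\<close>
    moreover have "a \<notin> set q"
      using apath_distinct_tails[OF Cons.prems(1)] by auto
    then have "set (takeWhile (\<lambda>a. tail G a \<notin> D) q) \<subseteq> set q'"
      using Cons.prems(3) False by (auto simp: p' tails \<open>a = a'\<close> dest: set_takeWhileD)
    ultimately show ?thesis
      using Cons.IH[of "head G a" q'] q by (simp add: p')
  qed (simp add: p' tails)
qed

end

section \<open>Simple paths as binary unit flows\<close>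

locale st_digraph = fin_digraph G for G :: "('n, 'e::finite) pre_digraph" +
  fixes s f :: 'n
  assumes arcs: "arcs G = UNIV"
    and nodes: "s \<in> verts G" "f \<in> verts G" "s \<noteq> f"
begin

text \<open>Tails on a simple path are distinct, so at most one summand is 1. The outflow sums in
  the program thereby indicate whether the path leaves a node.\<close>

lemma sum_out_arcs_apath:
  assumes "apath u p v"
  shows "(\<Sum>a\<in>out_arcs G i. incidence_vector p $ a) = (if i \<in> tail G ` set p then 1 else 0)"
proof -
  have "set p \<subseteq> arcs G"
    using assms by (auto simp: apath_def)
  have "(\<Sum>a\<in>out_arcs G i. incidence_vector p $ a) = real (card (out_arcs G i \<inter> set p))"
    by (simp flip: sum.inter_restrict)
  also have "out_arcs G i \<inter> set p = {a \<in> set p. tail G a = i}"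
    using \<open>set p \<subseteq> arcs G\<close> by auto
  also have "real (card \<dots>) = (if i \<in> tail G ` set p then 1 else 0)"
  proof (cases "i \<in> tail G ` set p")
    case True
    then obtain b where "b \<in> set p" "i = tail G b"
      by blast
    then have "{a \<in> set p. tail G a = i} = {b}"
      using apath_tail_inj[OF assms] by blast
    with True show ?thesis
      by simp
  next
    case False
    then have "{a \<in> set p. tail G a = i} = {}"
      by blast
    with False show ?thesis
      by simp
  qed
  finally show ?thesis .
qed

lemma sum_in_arcs_apath:
  assumes "apath u p v"
  shows "(\<Sum>a\<in>in_arcs G i. incidence_vector p $ a) = (if i \<in> head G ` set p then 1 else 0)"
proof -
  have "set p \<subseteq> arcs G"
    using assms by (auto simp: apath_def)
  have "(\<Sum>a\<in>in_arcs G i. incidence_vector p $ a) = real (card (in_arcs G i \<inter> set p))"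
    by (simp flip: sum.inter_restrict)
  also have "in_arcs G i \<inter> set p = {a \<in> set p. head G a = i}"
    using \<open>set p \<subseteq> arcs G\<close> by auto
  also have "real (card \<dots>) = (if i \<in> head G ` set p then 1 else 0)"
  proof (cases "i \<in> head G ` set p")
    case True
    then obtain b where "b \<in> set p" "i = head G b"
      by blast
    then have "{a \<in> set p. head G a = i} = {b}"
      using apath_distinct_heads[OF assms] by (auto simp: distinct_map dest: inj_onD)
    with True show ?thesis
      by simp
  next
    case False
    then have "{a \<in> set p. head G a = i} = {}"
      by blast
    with False show ?thesis
      by simp
  qed
  finally show ?thesis .
qed

lemma incidence_vector_in_flow_vectors:
  assumes "apath s p f"
  shows "incidence_vector p \<in> flow_vectors G s f"
proof -
  have "(if i \<in> tail G ` set p then 1 else 0) - (if i \<in> head G ` set p then 1 else 0)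
      = (if i = s then 1 else if i = f then -1 else (0 :: real))" for i
    using apath_tails_heads[OF assms(1)] apath_end_not_tail[OF assms(1)]
      apath_start_not_head[OF assms(1)] nodes(3) by auto
  then show ?thesis
    unfolding flow_vectors_def
    using sum_out_arcs_apath[OF assms(1)] sum_in_arcs_apath[OF assms(1)] by auto
qed

lemma path_up_to_tail:
  assumes "apath s (xs @ a # ys) f"
  shows "path_up_to G (tail G a) (xs @ a # ys) = xs"
proof -
  have "\<forall>b\<in>set xs. tail G b \<noteq> tail G a"
    using apath_distinct_tails[OF assms] by simp (metis image_eqI)
  then show ?thesis
    unfolding path_up_to_def by (subst takeWhile_append2) auto
qed

text \<open>Together with \<open>path_up_to_tail\<close> this shows that the segment grows by
  exactly one arc from tail to head, even at the last arc, whose head \<open>f\<close> is never a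
  tail.\<close>

lemma path_up_to_head:
  assumes "apath s (xs @ a # ys) f"
  shows "path_up_to G (head G a) (xs @ a # ys) = xs @ [a]"
proof (cases ys)
  case Nil
  have "head G a = f"
    using assms by (simp add: Nil apath_def awalk_simps)
  then have "\<forall>b\<in>set (xs @ [a]). tail G b \<noteq> head G a"
    using apath_end_not_tail[OF assms] Nil by (metis image_eqI)
  then show ?thesis
    unfolding path_up_to_def Nil by (subst takeWhile_eq_all_conv) auto
next
  case (Cons b zs)
  have "head G a = tail G b"
    using assms by (simp add: Cons apath_def awalk_simps)
  with path_up_to_tail[of "xs @ [a]" b zs] assms show ?thesis
    by (simp add: Cons)
qed

text \<open>Since \<open>t\<close> rises by at least 1 along flow arcs and is bounded, following the
  flow forward from \<open>s\<close> must end in \<open>f\<close>. Following it backward from any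
  flow arc must reach \<open>s\<close>, so every flow arc lies on that one path and no separate
  cycle remains.\<close>

lemma flow_vector_apath:
  fixes y :: "real ^ 'e" and t :: "'n \<Rightarrow> real"
  assumes y: "y \<in> flow_vectors G s f"
    and t: "\<And>a. y $ a = 1 \<Longrightarrow> t (tail G a) + 1 \<le> t (head G a)"
    and bounds: "\<And>i. i \<in> verts G \<Longrightarrow> 0 \<le> t i" "\<And>i. i \<in> verts G \<Longrightarrow> t i \<le> B"
  obtains p where "apath s p f" "y = incidence_vector p"
proof -
  have y01: "y $ a = 0 \<or> y $ a = 1" for a
    using y by (auto simp: flow_vectors_def)
  then have nonneg: "0 \<le> y $ a" for a
    by (metis order_refl zero_le_one)
  have balance: "(\<Sum>a\<in>out_arcs G i. y $ a) - (\<Sum>a\<in>in_arcs G i. y $ a)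
      = (if i = s then 1 else if i = f then -1 else 0)" "(\<Sum>a\<in>out_arcs G i. y $ a) \<le> 1"
    if "i \<in> verts G" for i
    using y that by (auto simp: flow_vectors_def)
  have ends: "tail G a \<in> verts G" "head G a \<in> verts G" for a
    using arcs by auto
  have out_ge: "(\<Sum>b\<in>out_arcs G (tail G a). y $ b) \<ge> 1" if "y $ a = 1" for a
    using member_le_sum[of a "out_arcs G (tail G a)" "\<lambda>b. y $ b"] that nonneg arcs by auto
  have in_ge: "(\<Sum>b\<in>in_arcs G (head G a). y $ b) \<ge> 1" if "y $ a = 1" for a
    using member_le_sum[of a "in_arcs G (head G a)" "\<lambda>b. y $ b"] that nonneg arcs by auto
  have ex_out: "\<exists>b. y $ b = 1 \<and> tail G b = i" if "(\<Sum>b\<in>out_arcs G i. y $ b) \<ge> 1" for i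
  proof (rule ccontr)
    assume "\<not> ?thesis"
    then have "(\<Sum>b\<in>out_arcs G i. y $ b) = 0"
      by (intro sum.neutral ballI) (metis in_out_arcs_conv y01)
    with that show False
      by simp
  qed
  have ex_in: "\<exists>b. y $ b = 1 \<and> head G b = i" if "(\<Sum>b\<in>in_arcs G i. y $ b) \<ge> 1" for i
  proof (rule ccontr)
    assume "\<not> ?thesis"
    then have "(\<Sum>b\<in>in_arcs G i. y $ b) = 0"
      by (intro sum.neutral ballI) (metis in_in_arcs_conv y01)
    with that show False
      by simp
  qed
  have unique: "a = b" if "y $ a = 1" "y $ b = 1" "tail G a = tail G b" for a b
  proof (rule ccontr)
    assume "a \<noteq> b"
    then have "(\<Sum>c\<in>{a, b}. y $ c) = 2"
      using that by simp
    moreover have "(\<Sum>c\<in>{a, b}. y $ c) \<le> (\<Sum>c\<in>out_arcs G (tail G a). y $ c)"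
      using that nonneg arcs by (intro sum_mono2) auto
    ultimately show False
      using balance(2)[OF ends(1), of a] by simp
  qed
  have start: "\<exists>b. y $ b = 1 \<and> tail G b = s"
    using balance(1)[OF nodes(1)] sum_nonneg[of "in_arcs G s" "\<lambda>a. y $ a"] nonneg
    by (intro ex_out) auto
  \<comment> \<open>Away from \<open>f\<close> the balance is nonnegative, so the outflow at the
    head is at least the inflow, which \<open>a\<close> makes at least 1. The fact
    \<open>pred\<close> is the mirror image away from \<open>s\<close>.\<close>
  have succ: "\<exists>b. y $ b = 1 \<and> tail G b = head G a" if "y $ a = 1" "head G a \<noteq> f" for a
    using balance(1)[OF ends(2), of a] in_ge[OF that(1)] that(2)
    by (intro ex_out) (auto split: if_splits)
  have pred: "\<exists>b. y $ b = 1 \<and> head G b = tail G a" if "y $ a = 1" "tail G a \<noteq> s" for a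
    using balance(1)[OF ends(1), of a] out_ge[OF that(1)] that(2)
    by (intro ex_in) (auto split: if_splits)
  have walk_apath: "apath u p v" if "awalk u p v" "\<forall>a\<in>set p. y $ a = 1" for u p v
  proof -
    have "sorted_wrt (<) (map t (awalk_verts u p))"
      using that t by (intro awalk_sorted) (auto, fastforce)
    then have "distinct (map t (awalk_verts u p))"
      by (simp only: strict_sorted_iff)
    then show ?thesis
      using that(1) by (simp add: apath_def distinct_map)
  qed
  \<comment> \<open>The potential is real-valued, so the induction uses a ceiling: a gain of at
    least 1 in \<open>t\<close> lowers the rounded distance to \<open>B\<close> strictly, and
    \<open>nat\<close> keeps this strict because the current distance is positive.\<close>
  have to_f: "\<exists>p. awalk (tail G a) (a # p) f \<and> (\<forall>b\<in>set (a # p). y $ b = 1)" if "y $ a = 1" for a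
    using that
  proof (induction a rule: measure_induct_rule[where f = "\<lambda>a. nat \<lceil>B - t (tail G a)\<rceil>"])
    case (less a)
    show ?case
    proof (cases "head G a = f")
      case True
      then show ?thesis
        using less.prems nodes arcs by (intro exI[of _ "[]"]) (simp add: awalk_simps)
    next
      case False
      then obtain b where b: "y $ b = 1" "tail G b = head G a"
        using succ less.prems by blast
      have "B - t (tail G b) + 1 \<le> B - t (tail G a)" "0 < B - t (tail G a)"
        using t[OF less.prems] bounds(2)[OF ends(2), of a] b(2) by auto
      then have "\<lceil>B - t (tail G b)\<rceil> < \<lceil>B - t (tail G a)\<rceil>" "0 < \<lceil>B - t (tail G a)\<rceil>"
        using ceiling_mono[of "B - t (tail G b) + 1"] by fastforce+
      then obtain p where "awalk (tail G b) (b # p) f" "\<forall>c\<in>set (b # p). y $ c = 1"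
        using less.IH[of b] b(1) by auto
      then show ?thesis
        using b less.prems arcs
        by (intro exI[of _ "b # p"]) (simp add: awalk_simps)
    qed
  qed
  obtain a0 where "y $ a0 = 1" "tail G a0 = s"
    using start by blast
  with to_f obtain p where p: "awalk s p f" "\<forall>b\<in>set p. y $ b = 1"
    by blast
  have "apath s p f"
    using walk_apath[OF p] .
  have on_p: "\<exists>b\<in>set p. tail G b = i" if "i \<in> set (awalk_verts s p)" "i \<noteq> f" for i
    using that awalk_verts_tails[OF p(1)] by auto
  \<comment> \<open>Backward induction on the potential: a predecessor arc already on
    \<open>p\<close> puts the tail of \<open>a\<close> on \<open>p\<close>, and only one flow arc
    leaves that tail.\<close>
  have covered: "a \<in> set p" if "y $ a = 1" for a
    using that
  proof (induction a rule: measure_induct_rule[where f = "\<lambda>a. nat \<lceil>t (tail G a)\<rceil>"])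
    case (less a)
    \<comment> \<open>A flow arc out of \<open>f\<close> would extend by \<open>to_f\<close> to a
      nonempty closed walk at \<open>f\<close>, while every walk along the flow is simple.\<close>
    have "tail G a \<noteq> f"
    proof
      assume "tail G a = f"
      with to_f[OF less.prems] obtain q where
          "awalk f (a # q) f" "\<forall>b\<in>set (a # q). y $ b = 1"
        by auto
      then have "apath f (a # q) f"
        by (rule walk_apath)
      then show False
        using apath_nonempty_ends by blast
    qed
    moreover have "tail G a \<in> set (awalk_verts s p)"
    proof (cases "tail G a = s")
      case True
      then show ?thesis
        using hd_in_awalk_verts(1)[OF p(1)] by simp
    next
      case False
      then obtain b where b: "y $ b = 1" "head G b = tail G a"
        using pred less.prems by blast
      have "t (tail G b) + 1 \<le> t (tail G a)" "0 < t (tail G a)"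
        using t[OF b(1)] bounds(1)[OF ends(1), of b] b(2) by auto
      then have "\<lceil>t (tail G b)\<rceil> < \<lceil>t (tail G a)\<rceil>" "0 < \<lceil>t (tail G a)\<rceil>"
        using ceiling_mono[of "t (tail G b) + 1"] by fastforce+
      then have "b \<in> set p"
        using less.IH[of b] b(1) by auto
      then show ?thesis
        using awalk_verts_arc2[OF p(1)] b(2) by metis
    qed
    ultimately obtain a' where "a' \<in> set p" "tail G a' = tail G a"
      using on_p by blast
    then show ?case
      using unique[of a' a] p(2) less.prems by auto
  qed
  have "y = incidence_vector p"
    unfolding vec_eq_iff using covered p(2) y01 by auto
  with \<open>apath s p f\<close> show ?thesis
    by (rule that)
qed

end


section \<open>Non-anticipativity constraints\<close>

context st_digraph
begin

lemma takeWhile_eq_of_nonanticipativity_constraints: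
  assumes x: "ordering_constraints G s J x" "nonanticipativity_constraints G J D x"
    and jk: "j \<in> J" "k \<in> J" "j \<noteq> k"
    and D: "D j k \<noteq> {}" "D j k \<subseteq> verts G - {f}"
    and p: "apath s p f" "y_var x j = incidence_vector p"
    and p': "apath s p' f" "y_var x k = incidence_vector p'"
  shows "takeWhile (\<lambda>a. tail G a \<notin> D j k) p = takeWhile (\<lambda>a. tail G a \<notin> D j k) p'"
proof (rule takeWhile_eq_if_subset[OF p(1) p'(1)], rule subsetI)
  fix a assume a: "a \<in> set (takeWhile (\<lambda>a. tail G a \<notin> D j k) p)"
  let ?i = "tail G a"
  have "a \<in> set p" "?i \<notin> D j k"
    using set_takeWhileD[OF a] by auto
  have i: "?i \<in> verts G - D j k"
    using arcs \<open>?i \<notin> D j k\<close> by auto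
  have con: "\<forall>n\<in>D j k.
      0 \<le> v_var x j ?i n \<and>
      v_var x j ?i n \<le> (real (card (verts G)) - 1) * vt_var x j ?i n \<and>
      v_var x j ?i n \<le> t_var x j ?i - t_var x j n + (real (card (verts G)) - 1) * (1 - vt_var x j ?i n) \<and>
      w_var x j ?i n \<le> v_var x j ?i n + 2 - (\<Sum>a\<in>out_arcs G n. y_var x j $ a)
                                       - (\<Sum>a\<in>out_arcs G ?i. y_var x j $ a) \<and>
      w_var x j ?i n \<le> (\<Sum>a\<in>out_arcs G n. y_var x j $ a) \<and>
      (\<forall>a\<in>out_arcs G ?i. y_var x j $ a - y_var x k $ a \<le> (\<Sum>n'\<in>D j k. w_var x j ?i n')) \<and>
      vt_var x j ?i n \<in> {0, 1}"
    using x(2) jk i unfolding nonanticipativity_constraints_def Let_def by blast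
  have step: "t_var x j (tail G b) < t_var x j (head G b)" if "b \<in> set p" for b
  proof -
    have "t_var x j (tail G b) - t_var x j (head G b)
        \<le> -1 + real (card (verts G)) * (1 - y_var x j $ b)"
      using x(1) jk(1) arcs unfolding ordering_constraints_def by blast
    with that show ?thesis
      by (simp add: p(2))
  qed
  have sorted: "sorted_wrt (<) (map (t_var x j) (map (tail G) p @ [f]))"
    using awalk_sorted[of s p f "t_var x j"] step p(1) awalk_verts_tails
    by (auto simp: apath_def)
  \<comment> \<open>An arc leaving a distinguishing node cannot lie in the prefix taken by
    \<open>takeWhile\<close>, so it lies behind \<open>a\<close>, where \<open>t\<close> is
    larger.\<close>
  have before: "t_var x j ?i < t_var x j n" if n: "n \<in> D j k" "n \<in> tail G ` set p" for n
  proof -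
    obtain b where b: "b \<in> set p" "tail G b = n"
      using n(2) by blast
    have "b \<notin> set (takeWhile (\<lambda>a. tail G a \<notin> D j k) p)"
      using b(2) n(1) by (auto dest: set_takeWhileD)
    then have "b \<in> set (dropWhile (\<lambda>a. tail G a \<notin> D j k) p)"
      using b(1) by (metis Un_iff set_append takeWhile_dropWhile_id)
    moreover have "sorted_wrt (<) (map (\<lambda>a. t_var x j (tail G a))
        (takeWhile (\<lambda>a. tail G a \<notin> D j k) p @ dropWhile (\<lambda>a. tail G a \<notin> D j k) p))"
      using sorted by (simp add: sorted_wrt_append comp_def)
    ultimately show ?thesis
      using a b(2) unfolding map_append sorted_wrt_append by auto
  qed
  \<comment> \<open>If \<open>n\<close> is on the path, \<open>t\<close> is smaller at
    \<open>?i\<close> than at \<open>n\<close>, so either binary value of \<open>vt_var\<close>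
    forces \<open>v_var \<le> 0\<close>, and both outflow sums are 1. If \<open>n\<close> is off the
    path, its outflow sum bounds \<open>w_var\<close> by 0.\<close>
  have "w_var x j ?i n \<le> 0" if n: "n \<in> D j k" for n
  proof (cases "n \<in> tail G ` set p")
    case True
    have "v_var x j ?i n \<le> 0"
      using con n before[OF n True] by fastforce
    moreover have "w_var x j ?i n \<le> v_var x j ?i n + 2 - 1 - 1"
      using con n True \<open>a \<in> set p\<close> unfolding p(2) sum_out_arcs_apath[OF p(1)] by auto
    ultimately show ?thesis
      by simp
  next
    case False
    then show ?thesis
      using con n unfolding p(2) sum_out_arcs_apath[OF p(1)] by auto
  qed
  then have "(\<Sum>n\<in>D j k. w_var x j ?i n) \<le> 0"
    by (rule sum_nonpos)
  \<comment> \<open>This constraint is quantified over \<open>n \<in> D j k\<close> as well, so it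
    is only available when that set is nonempty.\<close>
  moreover have "y_var x j $ a - y_var x k $ a \<le> (\<Sum>n\<in>D j k. w_var x j ?i n)"
    using con D(1) arcs by fastforce
  ultimately show "a \<in> set p'"
    using \<open>a \<in> set p\<close> by (auto simp: p(2) p'(2) split: if_splits)
qed

section \<open>Completion of given paths to values of the auxiliary variables\<close>

definition position :: "'e list \<Rightarrow> 'n \<Rightarrow> real" where
  "position p i = real (length (path_up_to G i p))"

lemma position_nonneg: "0 \<le> position p i"
  by (simp add: position_def)

text \<open>A node that is no tail on \<open>p\<close> gets the default value
  \<open>length p\<close>, as \<open>takeWhile\<close> never stops. This is in range because a
  simple path has fewer arcs than the graph has nodes.\<close>

lemma position_le:
  assumes "apath s p f"
  shows "position p i \<le> real (card (verts G)) - 1"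
proof -
  have "length (path_up_to G i p) \<le> length p"
    unfolding path_up_to_def by (rule length_takeWhile_le)
  with length_apath_less[OF assms] show ?thesis
    unfolding position_def by linarith
qed

lemma position_start: "apath s p f \<Longrightarrow> position p s = 0"
  using nodes(3) by (cases p) (auto simp: position_def path_up_to_def apath_simps)

lemma position_arc:
  assumes "apath s p f" "a \<in> set p"
  shows "position p (head G a) = position p (tail G a) + 1"
proof -
  obtain xs ys where "p = xs @ a # ys"
    using split_list[OF assms(2)] by blast
  with assms(1) show ?thesis
    by (simp add: position_def path_up_to_tail path_up_to_head)
qed

text \<open>The witness is the tail of the first arc outside the prefix; its position is the length
  of the prefix. For the nodes \<open>i\<close> considered, \<open>takeWhile\<close> passes at least
  that arc too, which also covers nodes off the path.\<close>

lemma position_first_distinguishing: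
  assumes "takeWhile (\<lambda>a. tail G a \<notin> D) p \<noteq> p"
  shows "\<exists>n\<in>D \<inter> tail G ` set p. \<forall>i. i \<notin> D \<union> tail G ` set (takeWhile (\<lambda>a. tail G a \<notin> D) p)
           \<longrightarrow> position p n + 1 \<le> position p i"
proof -
  define xs where "xs = takeWhile (\<lambda>a. tail G a \<notin> D) p"
  have "dropWhile (\<lambda>a. tail G a \<notin> D) p \<noteq> []"
    using assms by (metis append_Nil2 takeWhile_dropWhile_id)
  then obtain b ys where b: "dropWhile (\<lambda>a. tail G a \<notin> D) p = b # ys"
    by (meson neq_Nil_conv)
  then have "tail G b \<in> D"
    by (simp add: dropWhile_eq_Cons_conv)
  have p: "p = xs @ b # ys"
    unfolding xs_def b[symmetric] by simp
  have xs: "tail G a \<notin> D" if "a \<in> set xs" for a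
    using that unfolding xs_def by (auto dest: set_takeWhileD)
  have "position p (tail G b) = real (length xs)"
  proof -
    have "\<forall>a\<in>set xs. tail G a \<noteq> tail G b"
      using xs \<open>tail G b \<in> D\<close> by metis
    then show ?thesis
      unfolding position_def path_up_to_def p by (subst takeWhile_append2) auto
  qed
  moreover have "real (length xs) + 1 \<le> position p i"
    if "i \<notin> D" "i \<notin> tail G ` set xs" for i
  proof -
    have "\<forall>a\<in>set xs. tail G a \<noteq> i"
      using that(2) by (metis image_eqI)
    then show ?thesis
      using that(1) \<open>tail G b \<in> D\<close>
      unfolding position_def path_up_to_def p by (subst takeWhile_append2) auto
  qed
  ultimately show ?thesis
    unfolding xs_def[symmetric]
    using \<open>tail G b \<in> D\<close> by (intro bexI[of _ "tail G b"]) (simp, simp add: p)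
qed

text \<open>Here \<open>v\<close> is the positive part of the difference of positions,
  \<open>vt\<close> indicates its sign, and \<open>w\<close> takes the largest value its two upper
  bounds permit.\<close>

definition path_variables :: "(nat \<Rightarrow> 'e list) \<Rightarrow> (nat \<Rightarrow> real ^ 'e) \<Rightarrow> (nat \<Rightarrow> nat \<Rightarrow> real) \<Rightarrow> real
    \<Rightarrow> ('n, 'e) milp_vars" where
  "path_variables P y lm z =
     (let t = (\<lambda>j. position (P j));
          v = (\<lambda>j i n. max 0 (t j i - t j n))
      in \<lparr>y_var = y, t_var = t, v_var = v, vt_var = (\<lambda>j i n. if t j n < t j i then 1 else 0),
          w_var = (\<lambda>j i n. min (v j i n + 2 - (\<Sum>a\<in>out_arcs G n. y j $ a) - (\<Sum>a\<in>out_arcs G i. y j $ a))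
                               (\<Sum>a\<in>out_arcs G n. y j $ a)),
          lam_var = lm, z_var = z\<rparr>)"

lemma ordering_constraints_path_variables:
  assumes "\<And>j. j \<in> J \<Longrightarrow> apath s (P j) f" "\<And>j. j \<in> J \<Longrightarrow> y j = incidence_vector (P j)"
  shows "ordering_constraints G s J (path_variables P y lm z)"
  unfolding ordering_constraints_def path_variables_def Let_def milp_vars.simps
proof (intro ballI conjI)
  fix j assume j: "j \<in> J"
  show "position (P j) s = 0"
    using assms(1)[OF j] by (rule position_start)
  fix i
  show "0 \<le> position (P j) i" "position (P j) i \<le> real (card (verts G)) - 1"
    using position_nonneg position_le[OF assms(1)[OF j]] by auto
next
  fix j a assume j: "j \<in> J"
  show "position (P j) (tail G a) - position (P j) (head G a)
      \<le> -1 + real (card (verts G)) * (1 - y j $ a)"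
  proof (cases "a \<in> set (P j)")
    case True
    then show ?thesis
      using position_arc[OF assms(1)[OF j] True] assms(2)[OF j] by simp
  next
    \<comment> \<open>Off the path the right-hand side is the number of nodes minus 1, which bounds
      any difference of positions.\<close>
    case False
    then show ?thesis
      using assms(2)[OF j] position_nonneg[of "P j" "head G a"]
        position_le[OF assms(1)[OF j], of "tail G a"] by simp
  qed
qed

lemma nonanticipativity_constraints_path_variables:
  assumes P: "\<And>j. j \<in> J \<Longrightarrow> apath s (P j) f" and y: "\<And>j. j \<in> J \<Longrightarrow> y j = incidence_vector (P j)"
    and D: "\<And>j k. j \<in> J \<Longrightarrow> k \<in> J \<Longrightarrow> j \<noteq> k \<Longrightarrow> D j k \<subseteq> verts G - {f}"
    and na: "\<And>j k. j \<in> J \<Longrightarrow> k \<in> J \<Longrightarrow> j \<noteq> k \<Longrightarrow> nonanticipative G s (D j k) (P j) (P k)"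
  shows "nonanticipativity_constraints G J D (path_variables P y lm z)"
proof -
  define x where "x = path_variables P y lm z"
  have x: "y_var x = y" "t_var x j = position (P j)"
      "v_var x j i n = max 0 (position (P j) i - position (P j) n)"
      "vt_var x j i n = (if position (P j) n < position (P j) i then 1 else 0)"
      "w_var x j i n = min (v_var x j i n + 2 - (\<Sum>a\<in>out_arcs G n. y j $ a) - (\<Sum>a\<in>out_arcs G i. y j $ a))
                          (\<Sum>a\<in>out_arcs G n. y j $ a)" for j i n
    by (simp_all add: x_def path_variables_def Let_def)
  have out: "(\<Sum>a\<in>out_arcs G i. y j $ a) = (if i \<in> tail G ` set (P j) then 1 else 0)"
    if "j \<in> J" for i j
    unfolding y[OF that] by (rule sum_out_arcs_apath[OF P[OF that]])
  have w_nonneg: "0 \<le> w_var x j i n" if "j \<in> J" for i j n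
    unfolding x out[OF that] by auto
  \<comment> \<open>Three cases: a tail in the common prefix is left by the same arc on both paths;
    if the prefix is all of \<open>P j\<close>, the paths coincide; otherwise \<open>i\<close> comes
    after a distinguishing node and one summand is at least 1.\<close>
  have diff: "\<bar>y j $ a - y k $ a\<bar> \<le> (\<Sum>n\<in>D j k. w_var x j i n)"
    if jk: "j \<in> J" "k \<in> J" "j \<noteq> k" and i: "i \<in> verts G - D j k" and a: "a \<in> out_arcs G i" for i j k a
  proof -
    have "finite (D j k)" "f \<notin> D j k"
      using D[OF jk] finite_verts by (auto intro: finite_subset)
    have sum_nonneg: "0 \<le> (\<Sum>n\<in>D j k. w_var x j i n)"
      using w_nonneg[OF jk(1)] by (intro sum_nonneg) auto
    define pre where "pre = takeWhile (\<lambda>a. tail G a \<notin> D j k) (P j)"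
    have pre': "pre = takeWhile (\<lambda>a. tail G a \<notin> D j k) (P k)"
      using na[OF jk] nonanticipative_iff_takeWhile[OF P P \<open>f \<notin> D j k\<close>] jk
      unfolding pre_def by blast
    have sub: "set pre \<subseteq> set (P j)" "set pre \<subseteq> set (P k)"
      by (auto simp: pre_def dest: set_takeWhileD) (auto simp: pre' pre_def[symmetric] dest: set_takeWhileD)
    have eq: "y j $ a = y k $ a" if "a \<in> set (P j) \<longleftrightarrow> a \<in> set (P k)"
      using that by (simp add: y jk)
    show ?thesis
    proof (cases "i \<in> tail G ` set pre")
      case True
      then obtain b where b: "b \<in> set pre" "tail G b = tail G a"
        using a by auto
      have "a \<in> set (P j) \<longleftrightarrow> a = b" "a \<in> set (P k) \<longleftrightarrow> a = b"
        using apath_tail_inj[OF P[OF jk(1)]] apath_tail_inj[OF P[OF jk(2)]] b sub by blast+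
      with eq sum_nonneg show ?thesis
        by simp
    next
      case False
      show ?thesis
      proof (cases "pre = P j")
        case True
        then have "set (awalk_verts s (P j)) \<inter> D j k = {}"
          using \<open>f \<notin> D j k\<close> awalk_verts_tails[of s "P j" f] P[OF jk(1)]
          unfolding pre_def takeWhile_eq_all_conv by (auto simp: apath_def)
        then have "P j = P k"
          using na[OF jk] by (simp add: nonanticipative_def)
        with eq sum_nonneg show ?thesis
          by simp
      next
        case neq: False
        then have "takeWhile (\<lambda>a. tail G a \<notin> D j k) (P j) \<noteq> P j"
          by (simp add: pre_def)
        from position_first_distinguishing[OF this, folded pre_def] obtain n where
            n: "n \<in> D j k" "n \<in> tail G ` set (P j)"
              "i \<notin> D j k \<union> tail G ` set pre \<longrightarrow> position (P j) n + 1 \<le> position (P j) i"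
          by blast
        have after: "position (P j) n + 1 \<le> position (P j) i"
          using n(3) False i by blast
        \<comment> \<open>The positive part is at least 1, the outflow sum at \<open>n\<close> is 1
          and the one at \<open>i\<close> is at most 1, so both terms of the minimum are at least
          1.\<close>
        have "1 \<le> w_var x j i n"
          using n after
          unfolding x out[OF jk(1)] by auto
        also have "\<dots> \<le> (\<Sum>n\<in>D j k. w_var x j i n)"
          using n(1) \<open>finite (D j k)\<close> w_nonneg[OF jk(1)] by (intro member_le_sum) auto
        finally show ?thesis
          by (auto simp: y jk)
      qed
    qed
  qed
  \<comment> \<open>All positions lie between 0 and \<open>card (verts G) - 1\<close>, so this
    constant is large enough in both big-M constraints.\<close>
  have M1: "t_var x j i - t_var x j n \<le> real (card (verts G)) - 1" if "j \<in> J" for i j n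
    using position_le[OF P[OF that], of i] position_nonneg[of "P j" n] unfolding x by linarith
  have M1': "0 \<le> t_var x j i - t_var x j n + (real (card (verts G)) - 1)" if "j \<in> J" for i j n
    using position_le[OF P[OF that], of n] position_nonneg[of "P j" i] unfolding x by linarith
  show ?thesis
    unfolding nonanticipativity_constraints_def Let_def x_def[symmetric]
  proof (intro ballI impI conjI)
    fix j k n i
    assume jk: "j \<in> J" "k \<in> J" "j \<noteq> k" and n: "n \<in> D j k" and i: "i \<in> verts G - D j k"
    show "0 \<le> v_var x j i n" "t_var x j i - t_var x j n \<le> v_var x j i n" "vt_var x j i n \<in> {0, 1}"
      by (auto simp: x)
    show "v_var x j i n \<le> (real (card (verts G)) - 1) * vt_var x j i n"
      using M1[OF jk(1), of i n] by (auto simp: x)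
    show "v_var x j i n \<le> t_var x j i - t_var x j n
        + (real (card (verts G)) - 1) * (1 - vt_var x j i n)"
      using M1'[OF jk(1), of i n] by (auto simp: x)
    show "w_var x j i n \<le> v_var x j i n + 2 - (\<Sum>a\<in>out_arcs G n. y_var x j $ a)
                                       - (\<Sum>a\<in>out_arcs G i. y_var x j $ a)"
      "w_var x j i n \<le> (\<Sum>a\<in>out_arcs G n. y_var x j $ a)"
      unfolding x by simp_all
    fix a assume a: "a \<in> out_arcs G i"
    from diff[OF jk i a] show "- (\<Sum>n'\<in>D j k. w_var x j i n') \<le> y_var x j $ a - y_var x k $ a"
      "y_var x j $ a - y_var x k $ a \<le> (\<Sum>n'\<in>D j k. w_var x j i n')"
      by (simp_all only: x(1))
  qed
qed

end


section \<open>Reformulation of the worst-case loss\<close>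

text \<open>By \<open>key\<close>, the points of \<open>A\<close> at objective level
  \<open>z\<close> project onto the sublevel set of \<open>loss\<close> at \<open>z\<close>. Losses
  may be -\<infinity> while \<open>obj\<close> is real, so attainment is claimed for a finite
  infimum only.\<close>

lemma epigraph_reformulation:
  fixes obj :: "'x \<Rightarrow> real" and loss :: "'y \<Rightarrow> ereal"
  assumes key: "\<And>y z. (\<exists>x\<in>A. \<pi> x = y \<and> obj x = z) \<longleftrightarrow> y \<in> B \<and> loss y \<le> ereal z"
    and fin: "finite (loss ` B)"
  shows "(INF x\<in>A. ereal (obj x)) = (INF y\<in>B. loss y)"
    and "\<bar>INF x\<in>A. ereal (obj x)\<bar> \<noteq> \<infinity> \<Longrightarrow> \<exists>x. is_arg_min obj (\<lambda>x. x \<in> A) x"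
    and "is_arg_min obj (\<lambda>x. x \<in> A) x \<Longrightarrow> is_arg_min loss (\<lambda>y. y \<in> B) (\<pi> x)"
proof -
  show inf: "(INF x\<in>A. ereal (obj x)) = (INF y\<in>B. loss y)"
  proof (rule antisym)
    show "(INF x\<in>A. ereal (obj x)) \<le> (INF y\<in>B. loss y)"
    proof (rule INF_greatest)
      fix y assume "y \<in> B"
      show "(INF x\<in>A. ereal (obj x)) \<le> loss y"
      proof (rule ereal_le_real)
        fix z assume "loss y \<le> ereal z"
        with key[of y z] \<open>y \<in> B\<close> obtain x where "x \<in> A" "obj x = z"
          by blast
        then show "(INF x\<in>A. ereal (obj x)) \<le> ereal z"
          by (auto intro: INF_lower2)
      qed
    qed
    show "(INF y\<in>B. loss y) \<le> (INF x\<in>A. ereal (obj x))"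
    proof (rule INF_greatest)
      fix x assume "x \<in> A"
      with key[of "\<pi> x" "obj x"] have "\<pi> x \<in> B" "loss (\<pi> x) \<le> ereal (obj x)"
        by blast+
      then show "(INF y\<in>B. loss y) \<le> ereal (obj x)"
        by (rule INF_lower2)
    qed
  qed
  show "\<exists>x. is_arg_min obj (\<lambda>x. x \<in> A) x" if finite: "\<bar>INF x\<in>A. ereal (obj x)\<bar> \<noteq> \<infinity>"
  proof -
    obtain m where m: "(INF x\<in>A. ereal (obj x)) = ereal m"
      using finite by (cases "INF x\<in>A. ereal (obj x)") auto
    \<comment> \<open>An empty \<open>B\<close> would make the infimum \<infinity>; the infimum of a
      finite nonempty set of losses is one of them.\<close>
    have "B \<noteq> {}"
      using finite unfolding inf by (auto simp: top_ereal_def)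
    then have "(INF y\<in>B. loss y) \<in> loss ` B"
      using fin by (simp add: cInf_eq_Min)
    then obtain y where "y \<in> B" "loss y = ereal m"
      using m inf by auto
    with key[of y m] obtain x where x: "x \<in> A" "obj x = m"
      by auto
    have "m \<le> obj x'" if "x' \<in> A" for x'
      using INF_lower[OF that, of "\<lambda>x. ereal (obj x)"] by (simp add: m)
    with x show ?thesis
      unfolding is_arg_min_def by (intro exI[of _ x]) force
  qed
  show "is_arg_min loss (\<lambda>y. y \<in> B) (\<pi> x)" if min: "is_arg_min obj (\<lambda>x. x \<in> A) x"
  proof -
    have x: "x \<in> A" "\<not> (\<exists>x'. x' \<in> A \<and> obj x' < obj x)"
      using min by (auto simp: is_arg_min_def)
    then have B: "\<pi> x \<in> B" "loss (\<pi> x) \<le> ereal (obj x)"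
      using key[of "\<pi> x" "obj x"] by blast+
    have "\<not> loss y < loss (\<pi> x)" if "y \<in> B" for y
    proof
      \<comment> \<open>A real level strictly between \<open>loss y\<close> and \<open>obj x\<close>
        exists even for an infinite \<open>loss y\<close>, and by \<open>key\<close> some point of
        \<open>A\<close> attains it.\<close>
      assume "loss y < loss (\<pi> x)"
      also note B(2)
      finally obtain z where "loss y < ereal z" "ereal z < ereal (obj x)"
        using ereal_dense2 by blast
      with key[of y z] \<open>y \<in> B\<close> x(2) show False
        by auto
    qed
    with B(1) show ?thesis
      by (auto simp: is_arg_min_def)
  qed
qed

section \<open>Worst-case loss in terms of expected costs\<close>

lemma integrable_ambiguity_set:
  assumes "Q \<in> ambiguity_set d l u ql qu E" "\<And>a. 1 \<le> d a" "\<And>a. ql a 1 = 1"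
  shows "integrable Q (\<lambda>c. c)"
proof -
  have Q: "prob_space Q" and sets: "sets Q = sets borel"
    using assms(1) by (auto simp: ambiguity_set_def distributions_def)
  interpret prob_space Q by fact
  have space: "space Q = UNIV"
    using sets_eq_imp_space_eq[OF sets] by simp
  have meas[measurable]: "(\<lambda>c. c $ a) \<in> borel_measurable Q" for a
    unfolding measurable_cong_sets[OF sets refl] by simp
  \<comment> \<open>The first interval of each arc carries probability 1, so almost surely the costs
    lie in a bounded box.\<close>
  have "AE c in Q. l a 1 \<le> c $ a \<and> c $ a \<le> u a 1" for a
  proof -
    have "measure (marginal Q a) {l a 1..u a 1} \<ge> 1"
      using assms(1) assms(2)[of a] assms(3)[of a]
      by (force simp: ambiguity_set_def marginal_set_def)
    moreover have "measure (marginal Q a) {l a 1..u a 1}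
        = prob ((\<lambda>c. c $ a) -` {l a 1..u a 1} \<inter> space Q)"
      unfolding marginal_def by (rule measure_distr) auto
    ultimately have "prob ((\<lambda>c. c $ a) -` {l a 1..u a 1} \<inter> space Q) = 1"
      using prob_le_1 by (intro antisym) auto
    then show ?thesis
      by (subst (asm) prob_eq_1) (auto elim!: eventually_mono)
  qed
  then have "AE c in Q. \<forall>a. l a 1 \<le> c $ a \<and> c $ a \<le> u a 1"
    by (simp add: AE_all_countable)
  then have "AE c in Q. norm c \<le> (\<Sum>a\<in>UNIV. \<bar>l a 1\<bar> + \<bar>u a 1\<bar>)"
  proof (eventually_elim)
    case (elim c)
    have "norm c \<le> (\<Sum>a\<in>UNIV. \<bar>c $ a\<bar>)"
      by (rule norm_le_l1_cart)
    also have "\<dots> \<le> (\<Sum>a\<in>UNIV. \<bar>l a 1\<bar> + \<bar>u a 1\<bar>)"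
    proof (rule sum_mono)
      fix a show "\<bar>c $ a\<bar> \<le> \<bar>l a 1\<bar> + \<bar>u a 1\<bar>"
        using spec[OF elim, of a] by linarith
    qed
    finally show ?case .
  qed
  then show ?thesis
    by (rule integrable_const_bound) (simp add: measurable_cong_sets[OF sets refl])
qed

text \<open>Integrability moves the inner product with \<open>y j\<close> out of the expectation, so
  a distribution matters only through its expected costs. An empty ambiguity set makes both sides
  vacuous for its scenario.\<close>

lemma ms_loss_le_iff:
  assumes int: "\<And>j Q. j \<in> J \<Longrightarrow> Q \<in> \<Q> j \<Longrightarrow> integrable Q (\<lambda>c. c)"
    and described: "\<And>j. j \<in> J \<Longrightarrow> expected_costs (\<Q> j) = solution_set (S j)"
  shows "ms_loss J \<Q> y \<le> ereal z \<longleftrightarrow> (\<forall>j\<in>J. \<forall>c\<in>solution_set (S j). c \<bullet> y j \<le> z)"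
proof -
  have "ms_loss J \<Q> y \<le> ereal z \<longleftrightarrow> (\<forall>j\<in>J. \<forall>Q\<in>\<Q> j. (\<integral>c. c \<bullet> y j \<partial>Q) \<le> z)"
    by (simp add: ms_loss_def SUP_le_iff)
  also have "\<dots> \<longleftrightarrow> (\<forall>j\<in>J. \<forall>Q\<in>\<Q> j. (\<integral>c. c \<partial>Q) \<bullet> y j \<le> z)"
    using int by (intro ball_cong refl) simp
  also have "\<dots> \<longleftrightarrow> (\<forall>j\<in>J. \<forall>c\<in>solution_set (S j). c \<bullet> y j \<le> z)"
    by (simp add: expected_costs_def flip: described)
  finally show ?thesis .
qed

text \<open>The feasible families are functions on all naturals and are unconstrained off
  \<open>J\<close>, but the loss only sees their restrictions to \<open>J\<close>, and there are
  finitely many simple paths.\<close>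

lemma (in st_digraph) finite_ms_loss: "finite (ms_loss J \<Q> ` ms_feasible G s f J D)" if "finite J"
proof (rule finite_subset)
  let ?Y = "incidence_vector ` {p. apath s p f}"
  show "finite (ms_loss J \<Q> ` (J \<rightarrow>\<^sub>E ?Y))"
    using that apaths_finite by (intro finite_imageI finite_PiE) auto
  show "ms_loss J \<Q> ` ms_feasible G s f J D \<subseteq> ms_loss J \<Q> ` (J \<rightarrow>\<^sub>E ?Y)"
  proof (rule image_subsetI)
    fix y assume "y \<in> ms_feasible G s f J D"
    then have "restrict y J \<in> J \<rightarrow>\<^sub>E ?Y"
      by (auto simp: ms_feasible_def)
    moreover have "ms_loss J \<Q> y = ms_loss J \<Q> (restrict y J)"
      by (simp add: ms_loss_def)
    ultimately show "ms_loss J \<Q> y \<in> ms_loss J \<Q> ` (J \<rightarrow>\<^sub>E ?Y)"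
      by blast
  qed
qed

text \<open>The level \<open>z\<close> can be prescribed exactly because the program bounds
  \<open>z_var\<close> only from below. Weak duality gives one direction,
  \<open>path_variables\<close> with multipliers from strong duality the other.\<close>

lemma (in st_digraph) milp_feasible_iff:
  assumes D: "\<And>j k. j \<in> J \<Longrightarrow> k \<in> J \<Longrightarrow> j \<noteq> k \<Longrightarrow> D j k \<noteq> {} \<and> D j k \<subseteq> verts G - {f}"
    and bounds: "\<And>j. j \<in> J \<Longrightarrow>
      \<exists>lb ub :: real ^ 'e. \<forall>a. (- axis a 1, - (lb $ a)) \<in> set (S j) \<and> (axis a 1, ub $ a) \<in> set (S j)"
  shows "(\<exists>x\<in>milp_feasible G s f J D S. y_var x = y \<and> z_var x = z)
    \<longleftrightarrow> y \<in> ms_feasible G s f J D \<and> (\<forall>j\<in>J. \<forall>c\<in>solution_set (S j). c \<bullet> y j \<le> z)"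
    (is "?milp \<longleftrightarrow> ?ms \<and> ?le")
proof
  assume ?milp
  then obtain x where ord: "ordering_constraints G s J x"
      and na: "nonanticipativity_constraints G J D x"
      and dual: "dual_constraints J S x"
      and flow: "\<And>j. j \<in> J \<Longrightarrow> y j \<in> flow_vectors G s f"
      and x: "y_var x = y" "z_var x = z"
    by (auto simp: milp_feasible_def)
  have "\<exists>p. apath s p f \<and> y j = incidence_vector p" if j: "j \<in> J" for j
  proof (rule flow_vector_apath[OF flow[OF j], of "t_var x j" "real (card (verts G)) - 1"])
    fix a assume "y j $ a = 1"
    moreover have "t_var x j (tail G a) - t_var x j (head G a)
        \<le> -1 + real (card (verts G)) * (1 - y j $ a)"
      using ord j arcs unfolding ordering_constraints_def x(1) by blast
    ultimately show "t_var x j (tail G a) + 1 \<le> t_var x j (head G a)"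
      by simp
  next
    fix i assume "i \<in> verts G"
    with ord j show "0 \<le> t_var x j i" "t_var x j i \<le> real (card (verts G)) - 1"
      unfolding ordering_constraints_def by auto
  qed blast
  then obtain P where P: "\<And>j. j \<in> J \<Longrightarrow> apath s (P j) f" "\<And>j. j \<in> J \<Longrightarrow> y j = incidence_vector (P j)"
    by metis
  have "nonanticipative G s (D j k) (P j) (P k)" if jk: "j \<in> J" "k \<in> J" "j \<noteq> k" for j k
  proof -
    have "takeWhile (\<lambda>a. tail G a \<notin> D j k) (P j) = takeWhile (\<lambda>a. tail G a \<notin> D j k) (P k)"
      using D[OF jk] P[OF jk(1)] P[OF jk(2)]
      by (intro takeWhile_eq_of_nonanticipativity_constraints[OF ord na jk]) (auto simp: x)
    moreover have "f \<notin> D j k"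
      using D[OF jk] by blast
    ultimately show ?thesis
      using nonanticipative_iff_takeWhile P(1) jk by blast
  qed
  with P have ?ms
    unfolding ms_feasible_def by blast
  moreover have ?le
  proof (intro ballI)
    fix j c assume j: "j \<in> J" and c: "c \<in> solution_set (S j)"
    have lm: "(\<Sum>r<length (S j). snd (S j ! r) * lam_var x j r) \<le> z"
        "y j = (\<Sum>r<length (S j). lam_var x j r *\<^sub>R fst (S j ! r))"
        "\<And>r. r < length (S j) \<Longrightarrow> 0 \<le> lam_var x j r"
      using dual j unfolding dual_constraints_def x by auto
    have "c \<bullet> y j \<le> (\<Sum>r<length (S j). snd (S j ! r) * lam_var x j r)"
      unfolding lm(2) using weak_duality[OF c lm(3)] by simp
    with lm(1) show "c \<bullet> y j \<le> z"
      by simp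
  qed
  ultimately show "?ms \<and> ?le" ..
next
  assume "?ms \<and> ?le"
  then have ?ms ?le
    by auto
  then obtain P where P: "\<And>j. j \<in> J \<Longrightarrow> apath s (P j) f" "\<And>j. j \<in> J \<Longrightarrow> y j = incidence_vector (P j)"
      and na: "\<And>j k. j \<in> J \<Longrightarrow> k \<in> J \<Longrightarrow> j \<noteq> k \<Longrightarrow> nonanticipative G s (D j k) (P j) (P k)"
    unfolding ms_feasible_def by blast
  have "\<exists>lm. (\<forall>r. 0 \<le> lm r) \<and> y j = (\<Sum>r<length (S j). lm r *\<^sub>R fst (S j ! r)) \<and>
      (\<Sum>r<length (S j). snd (S j ! r) * lm r) \<le> z" if j: "j \<in> J" for j
  proof -
    obtain lb ub :: "real ^ 'e" where
        "\<And>a. (- axis a 1, - (lb $ a)) \<in> set (S j)" "\<And>a. (axis a 1, ub $ a) \<in> set (S j)"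
      using bounds[OF j] by blast
    then show ?thesis
      by (rule strong_duality[of lb "S j" ub "y j" z]) (use \<open>?le\<close> j in blast)+
  qed
  then have "\<forall>j\<in>J. \<exists>lm. (\<forall>r. 0 \<le> lm r) \<and> y j = (\<Sum>r<length (S j). lm r *\<^sub>R fst (S j ! r)) \<and>
      (\<Sum>r<length (S j). snd (S j ! r) * lm r) \<le> z"
    by (rule ballI)
  from bchoice[OF this] obtain lm where
      lm: "\<forall>j\<in>J. (\<forall>r. 0 \<le> lm j r) \<and> y j = (\<Sum>r<length (S j). lm j r *\<^sub>R fst (S j ! r)) \<and>
        (\<Sum>r<length (S j). snd (S j ! r) * lm j r) \<le> z" ..
  define x where "x = path_variables P y lm z"
  have x: "y_var x = y" "z_var x = z" "lam_var x = lm"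
    by (simp_all add: x_def path_variables_def Let_def)
  have "ordering_constraints G s J x" "nonanticipativity_constraints G J D x"
    unfolding x_def
    using ordering_constraints_path_variables[OF P]
      nonanticipativity_constraints_path_variables[of J P y D, OF P _ na] D by auto
  moreover have "dual_constraints J S x"
    unfolding dual_constraints_def x using lm by auto
  moreover have "y j \<in> flow_vectors G s f" if "j \<in> J" for j
    using P[OF that] incidence_vector_in_flow_vectors by simp
  ultimately show ?milp
    using x by (auto simp: milp_feasible_def)
qed

theorem theorem2:
  fixes G :: "('n, 'e::finite) pre_digraph"
    and s f :: 'n
    and d :: "'e \<Rightarrow> nat"
    and l u ql qu :: "'e \<Rightarrow> nat \<Rightarrow> real"
    and E :: "'e linsys"
    and L :: "('n, 'e) aux_constraint list"
    and r :: "nat \<Rightarrow> bool list"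
    and S :: "nat \<Rightarrow> 'e linsys"
    and J :: "nat set"
    and \<Q> :: "nat \<Rightarrow> (real ^ 'e) measure set"
    and D :: "nat \<Rightarrow> nat \<Rightarrow> 'n set"
  assumes graph: "fin_digraph G" "nomulti_digraph G" "Digraph_Component.connected G"
    and arcs: "arcs G = UNIV"
    and nodes: "s \<in> verts G" "f \<in> verts G" "s \<noteq> f"
    and support: "\<And>a. 1 \<le> d a" "\<And>a. 0 \<le> l a 1" "\<And>a. l a 1 \<le> u a 1"
                 "\<And>a. ql a 1 = 1" "\<And>a. qu a 1 = 1"
    and aux: "\<forall>k \<in> set L. aux_wf G f k"
    and J: "J = {1..2 ^ length L}"
    and responses: "bij_betw r J {\<rho>. length \<rho> = length L}"
    and \<Q>: "\<And>j. \<Q> j = response_set G (ambiguity_set d l u ql qu E) L (r j)"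
    and D: "\<And>j k. D j k = distinguishing_nodes L (r j) (r k)"
    and form: "\<forall>j\<in>J. response_system G E L (r j) (S j)"
    and described: "\<forall>j\<in>J. expected_costs (\<Q> j) = solution_set (S j)"
    and subset: "\<forall>j\<in>J. solution_set (S j) \<subseteq> initial_polyhedron d l u ql qu E"
  shows "(INF x \<in> milp_feasible G s f J D S. ereal (z_var x))
           = (INF y \<in> ms_feasible G s f J D. ms_loss J \<Q> y)
         \<and> (\<bar>INF x \<in> milp_feasible G s f J D S. ereal (z_var x)\<bar> \<noteq> \<infinity>
             \<longrightarrow> (\<exists>x. is_arg_min z_var (\<lambda>x. x \<in> milp_feasible G s f J D S) x))
         \<and> (\<forall>x. is_arg_min z_var (\<lambda>x. x \<in> milp_feasible G s f J D S) x
             \<longrightarrow> is_arg_min (ms_loss J \<Q>) (\<lambda>y. y \<in> ms_feasible G s f J D) (y_var x))"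
proof -
  interpret fin_digraph G
    by fact
  interpret st_digraph G s f
    using arcs nodes by unfold_locales
  \<comment> \<open>Distinct scenarios have distinct response vectors of equal length, so they
    differ at some constraint, whose node lies in \<open>D j k\<close>.\<close>
  have D_nonempty: "D j k \<noteq> {} \<and> D j k \<subseteq> verts G - {f}" if jk: "j \<in> J" "k \<in> J" "j \<noteq> k" for j k
  proof
    have "length (r j) = length L" "length (r k) = length L"
      using bij_betwE[OF responses] jk by auto
    moreover have "r j \<noteq> r k"
      using responses jk by (auto simp: bij_betw_def dest: inj_onD)
    ultimately show "D j k \<noteq> {}"
      unfolding D distinguishing_nodes_def by (auto simp: list_eq_iff_nth_eq)
    have "assoc_node (L ! m) \<in> verts G - {f}" if "m < length L" for m
      using aux nth_mem[OF that] by (cases "L ! m") auto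
    then show "D j k \<subseteq> verts G - {f}"
      unfolding D distinguishing_nodes_def by blast
  qed
  have bounds: "\<exists>lb ub :: real ^ 'e. \<forall>a. (- axis a 1, - (lb $ a)) \<in> set (S j) \<and> (axis a 1, ub $ a) \<in> set (S j)"
    if "j \<in> J" for j
  proof -
    have "response_system G E L (r j) (S j)"
      using form that by blast
    then obtain lb ub :: "real ^ 'e" where
        "set (S j) = (\<Union>a. {(- axis a 1, - (lb $ a)), (axis a 1, ub $ a)}) \<union> set E
           \<union> expectation_rows G L (r j)"
      unfolding response_system_def by blast
    then show ?thesis
      by (intro exI[of _ lb] exI[of _ ub]) auto
  qed
  have int: "integrable Q (\<lambda>c. c)" if "j \<in> J" "Q \<in> \<Q> j" for j Q
  proof (rule integrable_ambiguity_set)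
    show "Q \<in> ambiguity_set d l u ql qu E"
      using that(2) by (simp add: \<Q> response_set_def)
  qed (use support in auto)
  have key: "(\<exists>x\<in>milp_feasible G s f J D S. y_var x = y \<and> z_var x = z)
      \<longleftrightarrow> y \<in> ms_feasible G s f J D \<and> ms_loss J \<Q> y \<le> ereal z" for y z
  proof -
    have "ms_loss J \<Q> y \<le> ereal z \<longleftrightarrow> (\<forall>j\<in>J. \<forall>c\<in>solution_set (S j). c \<bullet> y j \<le> z)"
      using described by (intro ms_loss_le_iff int) auto
    with milp_feasible_iff[of J D S y z, OF D_nonempty bounds] show ?thesis
      by simp
  qed
  have "finite J"
    by (simp add: J)
  note reformulation = epigraph_reformulation[of "milp_feasible G s f J D S" y_var z_var
      "ms_feasible G s f J D" "ms_loss J \<Q>", OF key finite_ms_loss[OF \<open>finite J\<close>]]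
  show ?thesis
    using reformulation by blast
qed

end
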